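(* Let $G=(V,E)$ be a finite digraph with minimum out-degree at least $d$ and maximum in-degree $\delta\le \frac{2^{d-1}-e}{ed}$. Then for every pair of distinct vertices $v_1,v_2\in V$ there exists a friendly partition of $G$ which separates $v_1$ and $v_2$.
   Context: Digraphs have no loops and no parallel arcs in the same direction. A friendly partition of $G=(V,E)$ is a partition $\{V_1,V_2\}$ of $V$ into two nonempty sets such that every vertex has at least one out-neighbor in its own part; it separates $v_1,v_2$ if they lie in different parts. $e$ is Euler's number. *)

theory Defs
  imports Complex_Main "Graph_Theory.Digraph" "HOL-Library.Disjoint_Sets"
begin

(* Min and Max are meaningful only for a finite nonempty vertex set. *)

definition min_out_degree :: "('a, 'b) pre_digraph \<Rightarrow> nat" where
  "min_out_degree G = Min (out_degree G ` verts G)"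

definition max_in_degree :: "('a, 'b) pre_digraph \<Rightarrow> nat" where
  "max_in_degree G = Max (in_degree G ` verts G)"

(* Nonemptiness of the parts is part of partition_on. *)
definition friendly_partition :: "('a, 'b) pre_digraph \<Rightarrow> 'a set set \<Rightarrow> bool" where
  "friendly_partition G P \<longleftrightarrow>
     partition_on (verts G) P \<and> card P = 2 \<and>
     (\<forall>X\<in>P. \<forall>v\<in>X. \<exists>w\<in>X. v \<rightarrow>\<^bsub>G\<^esub> w)"

definition separates :: "'a set set \<Rightarrow> 'a \<Rightarrow> 'a \<Rightarrow> bool" where
  "separates P u v \<longleftrightarrow> (\<exists>X\<in>P. \<exists>Y\<in>P. X \<noteq> Y \<and> u \<in> X \<and> v \<in> Y)"

end

theory Submission
  imports Defs
begin

text \<open>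
  Keep exactly \<open>d\<close> out-neighbours \<open>N v\<close> of every vertex, and pick a uniformly random subset \<open>B\<close> of
  the vertices with \<open>v1 \<in> B\<close> and \<open>v2 \<notin> B\<close>. The bad event at \<open>v\<close> is that all of \<open>N v\<close> lies on the
  other side of \<open>v\<close>. Conditioned on the sides of all vertices outside \<open>N v - {v1, v2}\<close>, it has
  probability at most \<open>2 ^ - (d - 1)\<close>: if \<open>N v\<close> contains both \<open>v1\<close> and \<open>v2\<close> it is impossible, and
  otherwise at least \<open>d - 1\<close> independent sides are prescribed. Hence only the events at those
  \<open>u \<noteq> v\<close> matter for which \<open>N v\<close> meets \<open>{u} \<union> N u\<close>; there are at most \<open>d * \<delta>\<close> of these, because
  each \<open>w \<in> N v\<close> accounts for \<open>w\<close> itself and its in-neighbours other than \<open>v\<close>. The lopsided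
  Lovasz Local Lemma applies. Including the vertex \<open>v\<close> itself in the support of its event, as in the
  ordinary Local Lemma, would only give \<open>(d + 1) * \<delta>\<close>.
\<close>

section \<open>The lopsided Local Lemma, in counting form\<close>

text \<open>Conditional probabilities over the uniform space \<open>\<Omega>\<close> appear as
  cardinalities cleared of denominators, so conditioning on an empty set needs no separate
  case.\<close>

lemma card_avoiding_insert:
  fixes \<Omega> :: "'b set" and A :: "'i \<Rightarrow> 'b set"
  assumes "finite \<Omega>"
    and "real (card (A j \<inter> (\<Omega> - \<Union>(A ` T)))) \<le> x * real (card (\<Omega> - \<Union>(A ` T)))"
  shows "(1 - x) * real (card (\<Omega> - \<Union>(A ` T))) \<le> real (card (\<Omega> - \<Union>(A ` insert j T)))"
proof -
  let ?g = "\<Omega> - \<Union>(A ` T)"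
  have "?g = (\<Omega> - \<Union>(A ` insert j T)) \<union> (A j \<inter> ?g)" by auto
  moreover have "card ((\<Omega> - \<Union>(A ` insert j T)) \<union> (A j \<inter> ?g))
      = card (\<Omega> - \<Union>(A ` insert j T)) + card (A j \<inter> ?g)"
    using assms(1) by (intro card_Un_disjoint) auto
  ultimately have "card ?g = card (\<Omega> - \<Union>(A ` insert j T)) + card (A j \<inter> ?g)" by metis
  then show ?thesis using assms(2) by (simp add: algebra_simps)
qed

text \<open>Split \<open>S\<close> into its part inside \<open>\<Gamma> i\<close> and the rest.
  Conditioning on the rest alone only enlarges the left-hand count, which \<open>dep\<close> then
  bounds by \<open>p\<close>. Restoring the elements of \<open>S\<close> in
  \<open>\<Gamma> i\<close> one at a time costs, by induction, a factor \<open>1 - x\<close> each,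
  at most \<open>D\<close> times in all; \<open>p \<le> x * (1 - x) ^ D\<close> absorbs this
  loss.\<close>

lemma lopsided_local_lemma_step:
  fixes \<Omega> :: "'b set" and A :: "'i \<Rightarrow> 'b set" and p x :: real
  assumes fin: "finite \<Omega>" "finite I"
    and D: "\<And>i. i \<in> I \<Longrightarrow> finite (\<Gamma> i) \<and> card (\<Gamma> i) \<le> D"
    and dep: "\<And>i S. i \<in> I \<Longrightarrow> S \<subseteq> I - \<Gamma> i - {i} \<Longrightarrow>
      real (card (A i \<inter> (\<Omega> - \<Union>(A ` S)))) \<le> p * real (card (\<Omega> - \<Union>(A ` S)))"
    and x: "0 \<le> x" "x < 1" "p \<le> x * (1 - x) ^ D"
    and "S \<subseteq> I" "i \<in> I - S"
  shows "real (card (A i \<inter> (\<Omega> - \<Union>(A ` S)))) \<le> x * real (card (\<Omega> - \<Union>(A ` S)))"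
  using assms(8,9)
proof (induction "card S" arbitrary: S i rule: less_induct)
  case less
  define good where "good T = \<Omega> - \<Union>(A ` T)" for T
  let ?S1 = "S \<inter> \<Gamma> i" and ?S2 = "S - \<Gamma> i"
  have finS: "finite S" using less.prems fin(2) finite_subset by blast
  have chain: "(1 - x) ^ card R * real (card (good ?S2)) \<le> real (card (good (R \<union> ?S2)))"
    if "R \<subseteq> ?S1" for R
  proof -
    have "finite R" using that finS finite_subset by blast
    then show ?thesis using that
    proof (induction R rule: finite_induct)
      case (insert j R)
      let ?T = "R \<union> ?S2"
      \<comment> \<open>The inclusion is strict because \<open>j\<close> lies in \<open>S\<close>
        and in \<open>\<Gamma> i\<close> but not in \<open>R\<close>, hence not in
        \<open>?T\<close>.\<close>
      have "card ?T < card S"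
        using insert finS by (intro psubset_card_mono) auto
      moreover have "?T \<subseteq> I" "j \<in> I - ?T" using insert less.prems by auto
      ultimately have "real (card (A j \<inter> good ?T)) \<le> x * real (card (good ?T))"
        unfolding good_def by (rule less.hyps)
      then have "(1 - x) * real (card (good ?T)) \<le> real (card (good (insert j ?T)))"
        unfolding good_def by (rule card_avoiding_insert[OF fin(1)])
      moreover have "(1 - x) * ((1 - x) ^ card R * real (card (good ?S2)))
          \<le> (1 - x) * real (card (good ?T))"
        using insert x by (intro mult_left_mono) auto
      ultimately show ?case using insert(1,2) by (simp add: mult.assoc)
    qed simp
  qed
  have "?S1 \<union> ?S2 = S" by auto
  then have c: "(1 - x) ^ card ?S1 * real (card (good ?S2)) \<le> real (card (good S))"
    using chain[of ?S1] by simp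
  have i: "i \<in> I" using less.prems by auto
  have "card ?S1 \<le> D" using D[OF i] by (meson Int_lower2 card_mono le_trans)
  then have "(1 - x) ^ D \<le> (1 - x) ^ card ?S1" using x by (intro power_decreasing) auto
  then have pw: "p \<le> x * (1 - x) ^ card ?S1"
    using x by (meson mult_left_mono order_trans)
  have "card (A i \<inter> good S) \<le> card (A i \<inter> good ?S2)"
    using fin(1) by (intro card_mono) (auto simp: good_def)
  then have "real (card (A i \<inter> good S)) \<le> real (card (A i \<inter> good ?S2))" by simp
  also have "\<dots> \<le> p * real (card (good ?S2))"
    unfolding good_def using less.prems by (intro dep) auto
  also have "\<dots> \<le> (x * (1 - x) ^ card ?S1) * real (card (good ?S2))"
    using pw by (intro mult_right_mono) auto
  also have "\<dots> \<le> x * real (card (good S))"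
    using c x by (simp add: mult.assoc mult_left_mono)
  finally show ?case unfolding good_def .
qed

text \<open>Excluding the events one by one keeps at least the positive fraction
  \<open>1 - x\<close> of the survivors each time, so the count never reaches zero.\<close>

lemma lopsided_local_lemma:
  fixes \<Omega> :: "'b set" and A :: "'i \<Rightarrow> 'b set" and p x :: real
  assumes fin: "finite \<Omega>" "finite I" and ne: "\<Omega> \<noteq> {}"
    and D: "\<And>i. i \<in> I \<Longrightarrow> finite (\<Gamma> i) \<and> card (\<Gamma> i) \<le> D"
    and dep: "\<And>i S. i \<in> I \<Longrightarrow> S \<subseteq> I - \<Gamma> i - {i} \<Longrightarrow>
      real (card (A i \<inter> (\<Omega> - \<Union>(A ` S)))) \<le> p * real (card (\<Omega> - \<Union>(A ` S)))"
    and x: "0 \<le> x" "x < 1" "p \<le> x * (1 - x) ^ D"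
  shows "\<Omega> - \<Union>(A ` I) \<noteq> {}"
proof -
  have "0 < card (\<Omega> - \<Union>(A ` T))" if "T \<subseteq> I" for T
  proof -
    have "finite T" using that fin(2) finite_subset by blast
    then show ?thesis using that
    proof (induction T rule: finite_induct)
      case empty
      then show ?case using fin(1) ne by (simp add: card_gt_0_iff)
    next
      case (insert j T)
      have "real (card (A j \<inter> (\<Omega> - \<Union>(A ` T)))) \<le> x * real (card (\<Omega> - \<Union>(A ` T)))"
        using insert by (intro lopsided_local_lemma_step[OF fin D dep x]) auto
      from card_avoiding_insert[where A = A, OF fin(1) this]
      have "(1 - x) * real (card (\<Omega> - \<Union>(A ` T))) \<le> real (card (\<Omega> - \<Union>(A ` insert j T)))" .
      moreover have "0 < (1 - x) * real (card (\<Omega> - \<Union>(A ` T)))"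
        using insert x by simp
      ultimately show ?case by linarith
    qed
  qed
  from this[of I] show ?thesis by force
qed

text \<open>For positive \<open>D\<close> this is the reciprocal of
  \<open>(1 + 1 / D) ^ D \<le> e\<close>.\<close>

lemma exp_minus_one_le_power:
  "exp (- 1) \<le> (1 - 1 / (real D + 1)) ^ D"
proof (cases "D = 0")
  case False
  then have pos: "0 < real D" by simp
  have "(1 + 1 / real D) ^ D \<le> exp (1 / real D) ^ D"
    by (intro power_mono) (auto simp: exp_ge_add_one_self)
  also have "\<dots> = exp 1" using pos by (simp flip: exp_of_nat_mult)
  finally have "inverse (exp 1) \<le> inverse ((1 + 1 / real D) ^ D)"
    using pos by (intro le_imp_inverse_le) (auto intro!: zero_less_power add_pos_pos)
  also have "\<dots> = (1 - 1 / (real D + 1)) ^ D"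
  proof -
    have "inverse (1 + 1 / real D) = 1 - 1 / (real D + 1)"
      using pos by (simp add: field_simps)
    then show ?thesis by (simp flip: power_inverse)
  qed
  finally show ?thesis by (simp add: exp_minus)
qed simp

lemma symmetric_lopsided_local_lemma:
  fixes \<Omega> :: "'b set" and A :: "'i \<Rightarrow> 'b set" and p :: real
  assumes "finite \<Omega>" "finite I" "\<Omega> \<noteq> {}"
    and "\<And>i. i \<in> I \<Longrightarrow> finite (\<Gamma> i) \<and> card (\<Gamma> i) \<le> D"
    and "\<And>i S. i \<in> I \<Longrightarrow> S \<subseteq> I - \<Gamma> i - {i} \<Longrightarrow>
      real (card (A i \<inter> (\<Omega> - \<Union>(A ` S)))) \<le> p * real (card (\<Omega> - \<Union>(A ` S)))"
    and p: "exp 1 * p * (real D + 1) \<le> 1"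
  shows "\<Omega> - \<Union>(A ` I) \<noteq> {}"
proof -
  have p': "p \<le> exp (- 1) * (1 / (real D + 1))"
  proof -
    have e: "exp (- 1) * exp 1 = (1::real)" by (simp flip: exp_add)
    have "p * (real D + 1) = (exp (- 1) * exp 1) * (p * (real D + 1))" unfolding e by simp
    also have "\<dots> = exp (- 1) * (exp 1 * p * (real D + 1))" by (simp only: mult.assoc)
    also have "\<dots> \<le> exp (- 1) * 1" using p by (intro mult_left_mono) simp_all
    finally have "p \<le> exp (- 1) / (real D + 1)" by (subst pos_le_divide_eq) simp_all
    then show ?thesis by simp
  qed
  have "\<exists>x. 0 \<le> x \<and> x < 1 \<and> p \<le> x * (1 - x) ^ D"
  \<comment> \<open>The usual choice \<open>x = 1 / (D + 1)\<close> would be 1 for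
    \<open>D = 0\<close>, violating \<open>x < 1\<close>; there \<open>exp (- 1)\<close> serves
    instead.\<close>
  proof (cases "D = 0")
    case True
    then show ?thesis using p' by (intro exI[of _ "exp (- 1)"]) auto
  next
    case False
    let ?x = "1 / (real D + 1)"
    have "exp (- 1) * ?x \<le> (1 - ?x) ^ D * ?x"
      by (intro mult_right_mono exp_minus_one_le_power) simp
    with p' have "p \<le> ?x * (1 - ?x) ^ D" by (simp only: mult.commute)
    moreover have "0 \<le> ?x" "?x < 1" using False by simp_all
    ultimately show ?thesis by blast
  qed
  then obtain x where x: "0 \<le> x" "x < 1" "p \<le> x * (1 - x) ^ D" by blast
  show ?thesis
    by (rule lopsided_local_lemma[where p = p and x = x and D = D and \<Gamma> = \<Gamma>])
      (use assms(1-5) x in simp_all)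
qed

section \<open>Probability and dependency bounds for isolated vertices\<close>

lemma card_isolating_sets_le:
  fixes N :: "'a \<Rightarrow> 'a set" and V :: "'a set" and v v1 v2 :: 'a
  defines "\<Omega> \<equiv> {B. B \<subseteq> V \<and> v1 \<in> B \<and> v2 \<notin> B}"
  defines "A \<equiv> \<lambda>v. {B. \<forall>w\<in>N v. w \<in> B \<longleftrightarrow> v \<notin> B}"
  assumes V: "finite V" and Nv: "N v \<subseteq> V" "v \<notin> N v" "card (N v) = d"
    and S: "\<And>u. u \<in> S \<Longrightarrow> insert u (N u) \<inter> N v = {}"
  shows "2 ^ (d - 1) * card (A v \<inter> (\<Omega> - \<Union>(A ` S))) \<le> card (\<Omega> - \<Union>(A ` S))"
proof (cases "v1 \<in> N v \<and> v2 \<in> N v")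
  case True
  then have "A v \<inter> (\<Omega> - \<Union>(A ` S)) = {}"
    unfolding A_def \<Omega>_def by blast
  then show ?thesis by simp
next
  case False
  define W where "W = N v - {v1, v2}"
  define f where "f = (\<lambda>(B, X). (B - W) \<union> X)"
  let ?good = "\<Omega> - \<Union>(A ` S)"
  have fin: "finite (N v)" using V Nv finite_subset by blast
  have "finite \<Omega>" unfolding \<Omega>_def using V by simp
  \<comment> \<open>At most one of \<open>v1\<close>, \<open>v2\<close> lies in \<open>N v\<close>,
    so \<open>W\<close> loses at most one of its \<open>d\<close> elements: hence the exponent
    \<open>d - 1\<close>.\<close>
  have "W = N v - {v1} \<or> W = N v - {v2}" using False unfolding W_def by blast
  then have "d - 1 \<le> card W" using Nv(3) fin
    by (auto simp: card_Diff_singleton_if)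
  then have cardW: "2 ^ (d - 1) \<le> card (Pow W)"
    using fin by (simp add: card_Pow W_def power_increasing)
  \<comment> \<open>Resampling \<open>W\<close> affects neither \<open>v\<close> nor the events in \<open>S\<close>, and an element of \<open>A v\<close> is
    determined by its trace outside \<open>W\<close>.\<close>
  have "inj_on f ((A v \<inter> ?good) \<times> Pow W)"
  proof (rule inj_onI, clarify)
    fix B X B' X'
    assume B: "B \<in> A v" "B' \<in> A v" and X: "X \<subseteq> W" "X' \<subseteq> W"
      and eq: "f (B, X) = f (B', X')"
    have eqX: "X = X'" and out: "B - W = B' - W" using eq X unfolding f_def by auto
    have "v \<notin> W" using Nv by (auto simp: W_def)
    then have "v \<in> B \<longleftrightarrow> v \<in> B'" using out by blast
    then have "w \<in> B \<longleftrightarrow> w \<in> B'" if "w \<in> W" for w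
      using that B unfolding A_def W_def by blast
    then show "B = B' \<and> X = X'" using eqX out by blast
  qed
  moreover have "f ` ((A v \<inter> ?good) \<times> Pow W) \<subseteq> ?good"
  proof clarify
    fix B X assume B: "B \<in> \<Omega>" "B \<notin> \<Union>(A ` S)" and X: "X \<subseteq> W"
    have "f (B, X) \<in> \<Omega>" using B(1) X Nv unfolding \<Omega>_def f_def W_def by auto
    moreover have "f (B, X) \<notin> A u" if "u \<in> S" for u
    proof -
      have "w \<in> f (B, X) \<longleftrightarrow> w \<in> B" if "w \<in> insert u (N u)" for w
        using S[OF \<open>u \<in> S\<close>] that X unfolding f_def W_def by auto
      then show ?thesis using B(2) that unfolding A_def by auto
    qed
    ultimately show "f (B, X) \<in> ?good" by blast
  qed
  ultimately have "card ((A v \<inter> ?good) \<times> Pow W) \<le> card ?good"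
    using \<open>finite \<Omega>\<close> by (meson card_inj_on_le finite_Diff)
  then have "card (Pow W) * card (A v \<inter> ?good) \<le> card ?good"
    by (simp add: card_cartesian_product mult.commute)
  then show ?thesis using cardW by (meson le_trans mult_le_mono1)
qed

lemma card_meeting_neighbourhoods_le:
  fixes N :: "'a \<Rightarrow> 'a set"
  assumes "finite V" "v \<in> V" "N v \<subseteq> V" "card (N v) = d"
    and indeg: "\<And>w. w \<in> V \<Longrightarrow> card {u \<in> V. w \<in> N u} \<le> \<delta>"
  shows "card {u \<in> V. u \<noteq> v \<and> insert u (N u) \<inter> N v \<noteq> {}} \<le> d * \<delta>"
proof -
  let ?I = "\<lambda>w. {u \<in> V. w \<in> N u}"
  have finN: "finite (N v)" using assms finite_subset by blast
  \<comment> \<open>If \<open>u\<close> itself lies in \<open>N v\<close>, take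
    \<open>w = u\<close>; otherwise take a common element \<open>w\<close> of \<open>N u\<close> and
    \<open>N v\<close>.\<close>
  have "{u \<in> V. u \<noteq> v \<and> insert u (N u) \<inter> N v \<noteq> {}} \<subseteq> (\<Union>w\<in>N v. insert w (?I w - {v}))"
    by auto
  then have "card {u \<in> V. u \<noteq> v \<and> insert u (N u) \<inter> N v \<noteq> {}}
      \<le> card (\<Union>w\<in>N v. insert w (?I w - {v}))"
    using finN assms(1) by (intro card_mono) auto
  also have "\<dots> \<le> (\<Sum>w\<in>N v. card (insert w (?I w - {v})))"
    using finN by (rule card_UN_le)
  also have "\<dots> \<le> (\<Sum>w\<in>N v. \<delta>)"
  proof (rule sum_mono)
    fix w assume w: "w \<in> N v"
    have "card (insert w (?I w - {v})) \<le> Suc (card (?I w - {v}))"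
      by (rule card_insert_le_m1[of "Suc _", simplified]) simp
    \<comment> \<open>Since \<open>w \<in> N v\<close>, the vertex \<open>v\<close> belongs to
      \<open>?I w\<close>; its removal pays for the insertion of \<open>w\<close>.\<close>
    also have "\<dots> = card (?I w)"
      using assms w by (intro card_Suc_Diff1) auto
    also have "\<dots> \<le> \<delta>" using indeg w assms(3) by blast
    finally show "card (insert w (?I w - {v})) \<le> \<delta>" .
  qed
  finally show ?thesis using assms(4) by simp
qed

text \<open>The Local Lemma with \<open>p = 1 / 2 ^ (d - 1)\<close> and
  \<open>D = d * \<delta>\<close>; \<open>bound\<close> is its numerical condition after multiplying
  by \<open>2 ^ (d - 1)\<close>.\<close>

lemma ex_separating_set_without_isolated:
  fixes N :: "'a \<Rightarrow> 'a set" and V :: "'a set"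
  assumes V: "finite V" "v1 \<in> V" "v1 \<noteq> v2"
    and N: "\<And>v. v \<in> V \<Longrightarrow> N v \<subseteq> V \<and> v \<notin> N v \<and> card (N v) = d"
    and indeg: "\<And>w. w \<in> V \<Longrightarrow> card {u \<in> V. w \<in> N u} \<le> \<delta>"
    and bound: "exp 1 * (real d * real \<delta> + 1) \<le> 2 ^ (d - 1)"
  shows "\<exists>B\<subseteq>V. v1 \<in> B \<and> v2 \<notin> B \<and> (\<forall>v\<in>V. \<exists>w\<in>N v. w \<in> B \<longleftrightarrow> v \<in> B)"
proof -
  define \<Omega> where "\<Omega> = {B. B \<subseteq> V \<and> v1 \<in> B \<and> v2 \<notin> B}"
  define A where "A = (\<lambda>v. {B. \<forall>w\<in>N v. w \<in> B \<longleftrightarrow> v \<notin> B})"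
  define \<Gamma> where "\<Gamma> v = {u \<in> V. u \<noteq> v \<and> insert u (N u) \<inter> N v \<noteq> {}}" for v
  have "\<Omega> - \<Union>(A ` V) \<noteq> {}"
  proof (rule symmetric_lopsided_local_lemma)
    show "finite \<Omega>" unfolding \<Omega>_def using V by simp
    show "\<Omega> \<noteq> {}" unfolding \<Omega>_def using V by (auto intro!: exI[of _ "{v1}"])
    show "finite (\<Gamma> v) \<and> card (\<Gamma> v) \<le> d * \<delta>" if "v \<in> V" for v
    proof
      show "finite (\<Gamma> v)" unfolding \<Gamma>_def using V by simp
      show "card (\<Gamma> v) \<le> d * \<delta>"
        unfolding \<Gamma>_def using N[OF that]
        by (intro card_meeting_neighbourhoods_le V(1) that indeg) auto
    qed
    show "real (card (A v \<inter> (\<Omega> - \<Union>(A ` S)))) \<le> (1 / 2 ^ (d - 1)) * real (card (\<Omega> - \<Union>(A ` S)))"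
      if "v \<in> V" "S \<subseteq> V - \<Gamma> v - {v}" for v S
    proof -
      have "insert u (N u) \<inter> N v = {}" if "u \<in> S" for u
        using that \<open>S \<subseteq> _\<close> unfolding \<Gamma>_def by blast
      then have "2 ^ (d - 1) * card (A v \<inter> (\<Omega> - \<Union>(A ` S))) \<le> card (\<Omega> - \<Union>(A ` S))"
        unfolding A_def \<Omega>_def using N[OF \<open>v \<in> V\<close>]
        by (intro card_isolating_sets_le V(1)) simp_all
      then have "real (2 ^ (d - 1) * card (A v \<inter> (\<Omega> - \<Union>(A ` S)))) \<le> real (card (\<Omega> - \<Union>(A ` S)))"
        by (rule of_nat_mono)
      then show ?thesis by (simp add: pos_le_divide_eq mult.commute)
    qed
    show "exp 1 * (1 / 2 ^ (d - 1)) * (real (d * \<delta>) + 1) \<le> 1"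
    proof -
      have "exp 1 * (1 / 2 ^ (d - 1)) * (real (d * \<delta>) + 1)
          = exp 1 * (real d * real \<delta> + 1) / 2 ^ (d - 1)" by simp
      also have "\<dots> \<le> 1" using bound by (subst divide_le_eq_1_pos) simp_all
      finally show ?thesis .
    qed
  qed (rule V(1))
  then obtain B where B: "B \<in> \<Omega>" "B \<notin> \<Union>(A ` V)" by blast
  have "\<exists>w\<in>N v. w \<in> B \<longleftrightarrow> v \<in> B" if "v \<in> V" for v
    using B(2) that unfolding A_def by auto
  then show ?thesis using B(1) unfolding \<Omega>_def by (intro exI[of _ B]) simp
qed

section \<open>Passage from the digraph to neighbour sets and back\<close>

theorem theorem1p10:
  fixes G :: "('a, 'b) pre_digraph" and d \<delta> :: nat
  assumes "digraph G"
    and "d \<ge> 1"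
    and "min_out_degree G \<ge> d"
    and "max_in_degree G = \<delta>"
    and "real \<delta> \<le> (2 ^ (d - 1) - exp 1) / (exp 1 * real d)"
  shows "\<forall>v1\<in>verts G. \<forall>v2\<in>verts G. v1 \<noteq> v2 \<longrightarrow>
    (\<exists>P. friendly_partition G P \<and> separates P v1 v2)"
proof (intro ballI impI)
  interpret digraph G by fact
  fix v1 v2 assume v: "v1 \<in> verts G" "v2 \<in> verts G" "v1 \<noteq> v2"
  have "\<exists>N. N \<subseteq> {w. v \<rightarrow>\<^bsub>G\<^esub> w} \<and> card N = d" if "v \<in> verts G" for v
  proof -
    have "min_out_degree G \<le> out_degree G v"
      unfolding min_out_degree_def using that by (intro Min_le) auto
    then have "d \<le> out_degree G v" using assms(3) by linarith
    \<comment> \<open>Without parallel arcs, distinct out-arcs of \<open>v\<close> have distinct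
      heads, so the out-degree counts out-neighbours.\<close>
    also have "\<dots> = card (head G ` out_arcs G v)"
      unfolding out_degree_def
      by (intro card_image[symmetric] inj_onI) (auto intro: no_multi_arcs simp: arc_to_ends_def)
    finally obtain N where "N \<subseteq> head G ` out_arcs G v" "card N = d"
      by (meson obtain_subset_with_card_n)
    moreover have "head G ` out_arcs G v \<subseteq> {w. v \<rightarrow>\<^bsub>G\<^esub> w}"
      by (auto intro: dominatesI simp: arc_to_ends_def)
    ultimately show ?thesis by blast
  qed
  then obtain N where N: "\<And>v. v \<in> verts G \<Longrightarrow> N v \<subseteq> {w. v \<rightarrow>\<^bsub>G\<^esub> w} \<and> card (N v) = d"
    by metis
  have "\<exists>B\<subseteq>verts G. v1 \<in> B \<and> v2 \<notin> B \<and> (\<forall>v\<in>verts G. \<exists>w\<in>N v. w \<in> B \<longleftrightarrow> v \<in> B)"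
  proof (rule ex_separating_set_without_isolated)
    show "N v \<subseteq> verts G \<and> v \<notin> N v \<and> card (N v) = d" if "v \<in> verts G" for v
    proof (intro conjI)
      show "N v \<subseteq> verts G" using N[OF that] adj_in_verts(2)[of v] by blast
      show "v \<notin> N v" using N[OF that] adj_not_same[of v] by blast
      show "card (N v) = d" using N[OF that] by blast
    qed
    show "card {u \<in> verts G. w \<in> N u} \<le> \<delta>" if "w \<in> verts G" for w
    proof -
      have "{u \<in> verts G. w \<in> N u} \<subseteq> tail G ` in_arcs G w"
      proof clarify
        fix u assume "u \<in> verts G" "w \<in> N u"
        then have "u \<rightarrow>\<^bsub>G\<^esub> w" using N by blast
        then obtain a where "a \<in> arcs G" "tail G a = u" "head G a = w"
          by (auto simp: arcs_ends_conv)
        then show "u \<in> tail G ` in_arcs G w" by (auto simp: in_arcs_def)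
      qed
      then have "card {u \<in> verts G. w \<in> N u} \<le> in_degree G w"
        unfolding in_degree_def by (meson finite_in_arcs surj_card_le)
      also have "\<dots> \<le> \<delta>"
        using assms(4) that unfolding max_in_degree_def by auto
      finally show ?thesis .
    qed
    \<comment> \<open>As \<open>d \<ge> 1\<close>, the denominator in the bound on
      \<open>\<delta>\<close> is positive and can be cleared.\<close>
    show "exp 1 * (real d * real \<delta> + 1) \<le> 2 ^ (d - 1)"
      using assms(2,5) by (simp add: pos_le_divide_eq algebra_simps)
  qed (use v in auto)
  then obtain B where B: "B \<subseteq> verts G" "v1 \<in> B" "v2 \<notin> B"
    and same: "\<And>v. v \<in> verts G \<Longrightarrow> \<exists>w\<in>N v. w \<in> B \<longleftrightarrow> v \<in> B" by blast
  let ?P = "{B, verts G - B}"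
  have same': "\<exists>w\<in>verts G. v \<rightarrow>\<^bsub>G\<^esub> w \<and> (w \<in> B \<longleftrightarrow> v \<in> B)" if "v \<in> verts G" for v
  proof -
    obtain w where "w \<in> N v" "w \<in> B \<longleftrightarrow> v \<in> B" using same \<open>v \<in> verts G\<close> by blast
    moreover from this(1) have "v \<rightarrow>\<^bsub>G\<^esub> w" using N[OF that] by blast
    moreover from this have "w \<in> verts G" by (rule adj_in_verts(2))
    ultimately show ?thesis by (intro bexI[of _ w] conjI)
  qed
  \<comment> \<open>Distinctness is what gives \<open>?P\<close> cardinality 2; \<open>v1\<close>
    and \<open>v2\<close> witness that the two parts are nonempty.\<close>
  have ne: "B \<noteq> verts G - B" using B by blast
  moreover have "partition_on (verts G) ?P"
    using B v by (intro partition_onI) (auto simp: disjnt_def)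
  moreover have "\<exists>w\<in>X. u \<rightarrow>\<^bsub>G\<^esub> w" if "X \<in> ?P" "u \<in> X" for X u
  proof -
    have "u \<in> verts G" using that B(1) by auto
    then obtain w where "w \<in> verts G" "u \<rightarrow>\<^bsub>G\<^esub> w" "w \<in> B \<longleftrightarrow> u \<in> B" using same' by blast
    then show ?thesis using that by (intro bexI[of _ w]) auto
  qed
  ultimately have "friendly_partition G ?P"
    unfolding friendly_partition_def by simp
  moreover have "separates ?P v1 v2" unfolding separates_def
    by (rule bexI[of _ B], rule bexI[of _ "verts G - B"]) (use B v ne in simp_all)
  ultimately show "\<exists>P. friendly_partition G P \<and> separates P v1 v2" by (intro exI conjI)
qed

end
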